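(* Let $G=\mathrm U(N)$ and let $W$ be the standard Brownian motion on $\mathfrak u(N)$ at time $1$. Let $\Gamma^{(1)},\dots,\Gamma^{(n)}$ be loops in the plane with lasso representations over a common collection of lassos, let $\Sigma$ be a finite collection of points in the associated space $\mathcal D$ of matching-color lasso pairs, and let $\pi(\Sigma)$, $K^{(1)},\dots,K^{(n)}$ be the associated pairing and point counts and $H^{(1)},\dots,H^{(n)}$ the associated regions. Then the sum of $$\big\langle W_{a^{(1)}_1a^{(1)}_2},\dots,W_{a^{(1)}_{K^{(1)}}a^{(1)}_{K^{(1)}+1}},\;\dots,\;W_{a^{(n)}_1a^{(n)}_2},\dots,W_{a^{(n)}_{K^{(n)}}a^{(n)}_{K^{(n)}+1}}\big\rangle_{\pi(\Sigma)}$$ over all $a^{(i)}_1,\dots,a^{(i)}_{K^{(i)}+1}\in[N]$ with $a^{(i)}_{K^{(i)}+1}=a^{(i)}_1$ for each $i$ is equal to $$(-1)^{|\Sigma|}N^{-n+\chi},$$ where $\chi$ is the sum of the Euler characteristics of the surfaces formed from $H^{(1)},\dots,H^{(n)}$ by gluing pairs of edges matched by $\pi(\Sigma)$ with the opposite orientation.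
   Context: $[N]=\{1,\dots,N\}$. $\mathfrak u(N)$ (skew-Hermitian matrices) has inner product $\langle X,Y\rangle=N\operatorname{Tr}(X^*Y)$, and $W=\sum_jB^{(j)}X_j$ with $(X_j)$ an orthonormal basis and $B^{(j)}$ independent standard real Gaussians; $W_{ab}$ are its matrix entries. For centered jointly Gaussian (complex) variables and a pairing $\pi$ (a permutation of $[2K]$ with all cycles of size $2$), $\langle Z_1,\dots,Z_{2K}\rangle_\pi:=\prod_{i<j,\ \pi(i)=j}\mathbb E[Z_iZ_j]$ (equal to $1$ if $K=0$). Loops. In a graph in the plane with root $v$, a lasso associated to a bounded face $F$ is a loop $\alpha\cdot\partial F\cdot\alpha^{-1}$ with $\alpha$ a path from $v$ to a boundary vertex of $F$; one lasso per bounded face gives a basis $\lambda_1,\dots,\lambda_L$ of the free group of reduced loops based at $v$. The loop $\Gamma^{(i)}$ has lasso representation (its word in this basis) $\lambda_{c^{(i)}(1)}^{\varepsilon^{(i)}(1)}\cdots\lambda_{c^{(i)}(M^{(i)})}^{\varepsilon^{(i)}(M^{(i)})}$. Put $M=\sum_iM^{(i)}$ and let $c:[M]\to[L]$ be the concatenation of the $c^{(i)}$. Points and pairing. $\mathcal C=\{(m,m^* ):m<m^*,\ c(m)=c(m^* )\}$ and $\mathcal D=\bigsqcup_{(m,m^* )\in\mathcal C}D_{(m,m^* )}$, where $D_{(m,m^* )}$ is a copy of the region bounded by $\lambda_{c(m)}$, parametrized by $[0,1]$ via a space-filling curve, so that points of $\mathcal D$ are written $((m,m^* ),t)$. $\pi(\Sigma)$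 is the pairing of the lexicographically ordered set $\bigcup_{((m,m^* ),t)\in\Sigma}\{(m,t),(m^*,t)\}$ (identified with $[2|\Sigma|]$ by the order-preserving map) that pairs $(m,t)$ and $(m^*,t)$ for each $((m,m^* ),t)\in\Sigma$. $K^{(i)}$ is the number of elements $(m,t)$ of this set whose position $m$ lies in the $i$-th word, i.e. $M^{(1)}+\dots+M^{(i-1)}<m\le M^{(1)}+\dots+M^{(i)}$; so $\sum_iK^{(i)}=2|\Sigma|$. Regions. $H^{(i)}$ is a region with disk topology whose boundary is a directed cycle graph with $K^{(i)}$ edges (if $K^{(i)}=0$, $H^{(i)}$ has the sphere topology). The vertices of the boundaries are labeled $1,\dots,2|\Sigma|$, in order from $i=1$ to $n$ and in cyclic order around each boundary; $s$ is the permutation of $[2|\Sigma|]$ sending each label to the next one cyclically on the same boundary, so the edges go from $p$ to $s(p)$. $\pi(\Sigma)$ matches the edge with vertices $p,s(p)$ to the edge with vertices $q,s(q)$ whenever $\pi(\Sigma)$ transposes $p$ and $q$. Gluing two directed edges with the opposite orientation identifies the initial vertex of each with the terminal vertex of the other. *)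

theory Defs
  imports "HOL-Probability.Probability" "HOL-Complex_Analysis.Complex_Analysis"
begin

section \<open>The Gaussian matrix on the Lie algebra of U(N)\<close>

definition hermitian_adjoint :: "complex^'N^'N \<Rightarrow> complex^'N^'N" where
  "hermitian_adjoint A = (\<chi> i j. cnj (A $ j $ i))"

definition u_algebra :: "(complex^'N^'N) set" where
  "u_algebra = {A. hermitian_adjoint A = - A}"

text \<open>On skew-Hermitian matrices this is real-valued.\<close>
definition u_inner :: "complex^'N^'N \<Rightarrow> complex^'N^'N \<Rightarrow> complex" where
  "u_inner X Y = of_nat CARD('N) * trace (hermitian_adjoint X ** Y)"

text \<open>\<open>span\<close> is the span over the reals.\<close>
definition u_orthonormal_basis :: "'j set \<Rightarrow> ('j \<Rightarrow> complex^'N^'N) \<Rightarrow> bool" where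
  "u_orthonormal_basis J X \<longleftrightarrow>
     finite J \<and> span (X ` J) = u_algebra \<and>
     (\<forall>i\<in>J. \<forall>j\<in>J. u_inner (X i) (X j) = (if i = j then 1 else 0))"

text \<open>The standard Brownian motion on \<open>u_algebra\<close> at time 1, with coordinates \<open>B j\<close> in the
  orthonormal basis \<open>X j\<close>.\<close>
definition u_brownian_at_one ::
  "'a measure \<Rightarrow> 'j set \<Rightarrow> ('j \<Rightarrow> complex^'N^'N) \<Rightarrow> ('j \<Rightarrow> 'a \<Rightarrow> real) \<Rightarrow>
     ('a \<Rightarrow> complex^'N^'N) \<Rightarrow> bool" where
  "u_brownian_at_one M J X B W \<longleftrightarrow>
     u_orthonormal_basis J X \<and>
     (\<forall>j\<in>J. distributed M lborel (B j) std_normal_density) \<and>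
     prob_space.indep_vars M (\<lambda>_. borel) B J \<and>
     (\<forall>\<omega>\<in>space M. W \<omega> = (\<Sum>j\<in>J. B j \<omega> *\<^sub>R X j))"

definition wick_product ::
  "'a measure \<Rightarrow> nat \<Rightarrow> (nat \<Rightarrow> nat) \<Rightarrow> (nat \<Rightarrow> 'a \<Rightarrow> complex) \<Rightarrow> complex" where
  "wick_product M k \<pi> Z =
     (\<Prod>(p, q)\<in>{(p, q). p \<in> {1..2 * k} \<and> q \<in> {1..2 * k} \<and> p < q \<and> \<pi> p = q}.
        integral\<^sup>L M (\<lambda>\<omega>. Z p \<omega> * Z q \<omega>))"


section \<open>Graphs in the plane, loops and lassos\<close>

text \<open>Edges are arcs or simple closed curves meeting the vertices only at their ends. A directed
  edge is an edge with a flag: \<open>True\<close> for the given orientation, \<open>False\<close> for its reverse.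
  The graph is connected, so that every bounded face is simply connected and can be reached from
  the root.\<close>

type_synonym 'e walk = "('e \<times> bool) list"

definition graph_support :: "complex set \<Rightarrow> 'e set \<Rightarrow> ('e \<Rightarrow> real \<Rightarrow> complex) \<Rightarrow> complex set" where
  "graph_support V E \<gamma> = V \<union> (\<Union>e\<in>E. path_image (\<gamma> e))"

definition plane_graph :: "complex set \<Rightarrow> 'e set \<Rightarrow> ('e \<Rightarrow> real \<Rightarrow> complex) \<Rightarrow> bool" where
  "plane_graph V E \<gamma> \<longleftrightarrow>
     finite V \<and> finite E \<and>
     (\<forall>e\<in>E. simple_path (\<gamma> e) \<and> pathstart (\<gamma> e) \<in> V \<and> pathfinish (\<gamma> e) \<in> V \<and>
        \<gamma> e ` {0<..<1} \<inter> V = {}) \<and>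
     (\<forall>e\<in>E. \<forall>e'\<in>E. e \<noteq> e' \<longrightarrow> \<gamma> e ` {0<..<1} \<inter> \<gamma> e' ` {0<..<1} = {}) \<and>
     connected (graph_support V E \<gamma>)"

definition bounded_faces ::
  "complex set \<Rightarrow> 'e set \<Rightarrow> ('e \<Rightarrow> real \<Rightarrow> complex) \<Rightarrow> complex set set" where
  "bounded_faces V E \<gamma> = {F \<in> components (- graph_support V E \<gamma>). bounded F}"

definition edge_curve :: "('e \<Rightarrow> real \<Rightarrow> complex) \<Rightarrow> 'e \<times> bool \<Rightarrow> real \<Rightarrow> complex" where
  "edge_curve \<gamma> d = (if snd d then \<gamma> (fst d) else reversepath (\<gamma> (fst d)))"

fun is_walk ::
  "'e set \<Rightarrow> ('e \<Rightarrow> real \<Rightarrow> complex) \<Rightarrow> complex \<Rightarrow> 'e walk \<Rightarrow> complex \<Rightarrow> bool" where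
  "is_walk E \<gamma> x [] y \<longleftrightarrow> x = y"
| "is_walk E \<gamma> x (d # ds) y \<longleftrightarrow>
     fst d \<in> E \<and> pathstart (edge_curve \<gamma> d) = x \<and>
     is_walk E \<gamma> (pathfinish (edge_curve \<gamma> d)) ds y"

fun walk_curve :: "('e \<Rightarrow> real \<Rightarrow> complex) \<Rightarrow> 'e walk \<Rightarrow> real \<Rightarrow> complex" where
  "walk_curve \<gamma> [] = undefined"
| "walk_curve \<gamma> [d] = edge_curve \<gamma> d"
| "walk_curve \<gamma> (d # d' # ds) = edge_curve \<gamma> d +++ walk_curve \<gamma> (d' # ds)"

definition opposite :: "'e \<times> bool \<Rightarrow> 'e \<times> bool" where
  "opposite d = (fst d, \<not> snd d)"

definition inverse_walk :: "'e walk \<Rightarrow> 'e walk" where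
  "inverse_walk ds = rev (map opposite ds)"

text \<open>Two loops are the same element of the free group of reduced loops iff they are related by
  inserting and deleting backtracks.\<close>
definition deletes_backtrack :: "'e walk \<Rightarrow> 'e walk \<Rightarrow> bool" where
  "deletes_backtrack ds ds' \<longleftrightarrow>
     (\<exists>xs d ys. ds = xs @ [d, opposite d] @ ys \<and> ds' = xs @ ys)"

definition same_reduced_loop :: "'e walk \<Rightarrow> 'e walk \<Rightarrow> bool" where
  "same_reduced_loop = equivclp deletes_backtrack"

text \<open>The closed walk \<open>b\<close> from \<open>x\<close> is the counterclockwise boundary walk of \<open>F\<close>. The map \<open>h\<close> is a
  homeomorphism of the open disk onto \<open>F\<close> with continuous extension to the closed disk (as for
  Caratheodory's extension of the Riemann map), so this also makes sense when the boundary
  of \<open>F\<close> is not a simple closed curve, e.g. when both sides of an edge belong to \<open>F\<close>.\<close>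
definition is_face_boundary ::
  "'e set \<Rightarrow> ('e \<Rightarrow> real \<Rightarrow> complex) \<Rightarrow> complex set \<Rightarrow> complex \<Rightarrow> 'e walk \<Rightarrow> bool" where
  "is_face_boundary E \<gamma> F x b \<longleftrightarrow>
     b \<noteq> [] \<and> is_walk E \<gamma> x b x \<and>
     (\<exists>h. continuous_on (cball 0 1) h \<and> inj_on h (ball 0 1) \<and> h ` ball 0 1 = F \<and>
        (\<forall>t\<in>{0..1}. h (cis (2 * pi * t)) = walk_curve \<gamma> b t)) \<and>
     (\<forall>z\<in>F. winding_number (walk_curve \<gamma> b) z = 1)"

definition is_lasso ::
  "'e set \<Rightarrow> ('e \<Rightarrow> real \<Rightarrow> complex) \<Rightarrow> complex \<Rightarrow> complex set \<Rightarrow> 'e walk \<Rightarrow> bool" where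
  "is_lasso E \<gamma> v F l \<longleftrightarrow>
     (\<exists>\<alpha> x b. is_walk E \<gamma> v \<alpha> x \<and> is_face_boundary E \<gamma> F x b \<and>
        l = \<alpha> @ b @ inverse_walk \<alpha>)"

definition lasso_basis ::
  "complex set \<Rightarrow> 'e set \<Rightarrow> ('e \<Rightarrow> real \<Rightarrow> complex) \<Rightarrow> complex \<Rightarrow> nat \<Rightarrow>
     (nat \<Rightarrow> complex set) \<Rightarrow> (nat \<Rightarrow> 'e walk) \<Rightarrow> bool" where
  "lasso_basis V E \<gamma> v L F l \<longleftrightarrow>
     bij_betw F {1..L} (bounded_faces V E \<gamma>) \<and> (\<forall>k\<in>{1..L}. is_lasso E \<gamma> v (F k) (l k))"

text \<open>A letter \<open>(k, True)\<close> stands for the \<open>k\<close>-th lasso, \<open>(k, False)\<close> for its inverse.\<close>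
type_synonym lasso_word = "(nat \<times> bool) list"

definition lasso_product :: "(nat \<Rightarrow> 'e walk) \<Rightarrow> lasso_word \<Rightarrow> 'e walk" where
  "lasso_product l w = concat (map (\<lambda>(k, \<epsilon>). if \<epsilon> then l k else inverse_walk (l k)) w)"

text \<open>The word need not be reduced; the reduced word of \<open>\<Gamma>\<close> is a special case.\<close>
definition lasso_representation ::
  "nat \<Rightarrow> (nat \<Rightarrow> 'e walk) \<Rightarrow> 'e walk \<Rightarrow> lasso_word \<Rightarrow> bool" where
  "lasso_representation L l \<Gamma> w \<longleftrightarrow>
     fst ` set w \<subseteq> {1..L} \<and> same_reduced_loop (lasso_product l w) \<Gamma>"


section \<open>Pairs of lassos of the same colour and the pairing given by a set of points\<close>

text \<open>The loops are numbered \<open>1,\<dots>,n\<close> and the positions in the concatenated word start at 1.\<close>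

definition full_word :: "nat \<Rightarrow> (nat \<Rightarrow> lasso_word) \<Rightarrow> lasso_word" where
  "full_word n w = concat (map w [1..<Suc n])"

definition colour :: "nat \<Rightarrow> (nat \<Rightarrow> lasso_word) \<Rightarrow> nat \<Rightarrow> nat" where
  "colour n w m = fst (full_word n w ! (m - 1))"

definition colour_pairs :: "nat \<Rightarrow> (nat \<Rightarrow> lasso_word) \<Rightarrow> (nat \<times> nat) set" where
  "colour_pairs n w =
     {(m, m'). 1 \<le> m \<and> m < m' \<and> m' \<le> length (full_word n w) \<and> colour n w m = colour n w m'}"

text \<open>A space-filling curve of the closed region.\<close>
definition parametrizes_region :: "(real \<Rightarrow> complex) \<Rightarrow> complex set \<Rightarrow> bool" where
  "parametrizes_region \<phi> F \<longleftrightarrow> path \<phi> \<and> path_image \<phi> = closure F"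

text \<open>With \<open>\<phi> k\<close> the space-filling curve for the \<open>k\<close>-th face, \<open>((m, m'), t)\<close> is the point
  \<open>\<phi> (colour n w m) t\<close> in the copy of the region that belongs to \<open>(m, m')\<close>.\<close>
type_synonym pair_point = "(nat \<times> nat) \<times> real"

definition pair_space :: "nat \<Rightarrow> (nat \<Rightarrow> lasso_word) \<Rightarrow> pair_point set" where
  "pair_space n w = colour_pairs n w \<times> {0..1}"

fun point_marks :: "pair_point \<Rightarrow> (nat \<times> real) set" where
  "point_marks ((m, m'), t) = {(m, t), (m', t)}"

definition marks :: "pair_point set \<Rightarrow> (nat \<times> real) set" where
  "marks \<Sigma> = (\<Union>x\<in>\<Sigma>. point_marks x)"

text \<open>Without this condition the two-element sets \<open>point_marks x\<close> do not form a pairing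
  of \<open>marks \<Sigma>\<close>, and \<open>marks \<Sigma>\<close> has fewer than \<open>2 * card \<Sigma>\<close> elements.\<close>
definition disjoint_marks :: "pair_point set \<Rightarrow> bool" where
  "disjoint_marks \<Sigma> \<longleftrightarrow> pairwise (\<lambda>x y. disjnt (point_marks x) (point_marks y)) \<Sigma>"

definition lex_le :: "nat \<times> real \<Rightarrow> nat \<times> real \<Rightarrow> bool" where
  "lex_le x y \<longleftrightarrow> fst x < fst y \<or> (fst x = fst y \<and> snd x \<le> snd y)"

text \<open>The rank in lexicographic order: the order isomorphism from \<open>marks \<Sigma>\<close>
  to \<open>{1..card (marks \<Sigma>)}\<close>.\<close>
definition mark_label :: "pair_point set \<Rightarrow> nat \<times> real \<Rightarrow> nat" where
  "mark_label \<Sigma> x = card {y \<in> marks \<Sigma>. lex_le y x}"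

definition mark_mate :: "pair_point set \<Rightarrow> nat \<times> real \<Rightarrow> nat \<times> real" where
  "mark_mate \<Sigma> x = (THE y. \<exists>z\<in>\<Sigma>. point_marks z = {x, y})"

definition point_pairing :: "pair_point set \<Rightarrow> nat \<Rightarrow> nat" where
  "point_pairing \<Sigma> p =
     (if p \<in> {1..2 * card \<Sigma>}
      then mark_label \<Sigma> (mark_mate \<Sigma> (the_inv_into (marks \<Sigma>) (mark_label \<Sigma>) p))
      else p)"

definition mark_count :: "(nat \<Rightarrow> lasso_word) \<Rightarrow> pair_point set \<Rightarrow> nat \<Rightarrow> nat" where
  "mark_count w \<Sigma> i =
     card {(m, t) \<in> marks \<Sigma>.
       (\<Sum>j\<in>{1..<i}. length (w j)) < m \<and> m \<le> (\<Sum>j\<in>{1..<i}. length (w j)) + length (w i)}"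


section \<open>Gluing the regions\<close>

text \<open>The boundary of the \<open>i\<close>-th region (\<open>1 \<le> i \<le> n\<close>) is a directed cycle with \<open>K i\<close> vertices,
  whose labels are the \<open>K i\<close> numbers following \<open>label_offset K i\<close>. The edge from \<open>p\<close>
  to \<open>next_label n K p\<close> is identified with its initial vertex \<open>p\<close>.\<close>

definition label_offset :: "(nat \<Rightarrow> nat) \<Rightarrow> nat \<Rightarrow> nat" where
  "label_offset K i = (\<Sum>j\<in>{1..<i}. K j)"

definition boundary_labels :: "(nat \<Rightarrow> nat) \<Rightarrow> nat \<Rightarrow> nat set" where
  "boundary_labels K i = {label_offset K i <.. label_offset K i + K i}"

definition region_of :: "nat \<Rightarrow> (nat \<Rightarrow> nat) \<Rightarrow> nat \<Rightarrow> nat" where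
  "region_of n K p = (THE i. i \<in> {1..n} \<and> p \<in> boundary_labels K i)"

definition next_label :: "nat \<Rightarrow> (nat \<Rightarrow> nat) \<Rightarrow> nat \<Rightarrow> nat" where
  "next_label n K p =
     (let i = region_of n K p
      in if p = label_offset K i + K i then label_offset K i + 1 else p + 1)"

definition all_labels :: "nat \<Rightarrow> (nat \<Rightarrow> nat) \<Rightarrow> nat set" where
  "all_labels n K = (\<Union>i\<in>{1..n}. boundary_labels K i)"

text \<open>The equivalence relation on vertices generated by gluing matched edges with the opposite
  orientation: the initial vertex of each is identified with the terminal vertex of the other.\<close>
definition vertex_gluing :: "nat \<Rightarrow> (nat \<Rightarrow> nat) \<Rightarrow> (nat \<Rightarrow> nat) \<Rightarrow> (nat \<times> nat) set" where
  "vertex_gluing n K \<pi> =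
     {(x, y). equivclp (\<lambda>x y. \<exists>p\<in>all_labels n K. \<exists>q\<in>all_labels n K. \<pi> p = q \<and> \<pi> q = p \<and> p \<noteq> q \<and>
        (x = p \<and> y = next_label n K q \<or> x = next_label n K p \<and> y = q)) x y}"

definition edge_gluing :: "nat \<Rightarrow> (nat \<Rightarrow> nat) \<Rightarrow> (nat \<Rightarrow> nat) \<Rightarrow> (nat \<times> nat) set" where
  "edge_gluing n K \<pi> =
     {(p, q). equivclp (\<lambda>p q. p \<in> all_labels n K \<and> q \<in> all_labels n K \<and> \<pi> p = q \<and> \<pi> q = p) p q}"

definition region_gluing :: "nat \<Rightarrow> (nat \<Rightarrow> nat) \<Rightarrow> (nat \<Rightarrow> nat) \<Rightarrow> (nat \<times> nat) set" where
  "region_gluing n K \<pi> =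
     {(i, j). equivclp (\<lambda>i j. i \<in> {1..n} \<and> j \<in> {1..n} \<and>
        (\<exists>p\<in>boundary_labels K i. \<exists>q\<in>boundary_labels K j. \<pi> p = q \<and> \<pi> q = p)) i j}"

text \<open>A surface is given by the set of regions it is glued from.\<close>
definition glued_surfaces :: "nat \<Rightarrow> (nat \<Rightarrow> nat) \<Rightarrow> (nat \<Rightarrow> nat) \<Rightarrow> nat set set" where
  "glued_surfaces n K \<pi> = {1..n} // region_gluing n K \<pi>"

text \<open>The Euler characteristic of the surface glued from the regions in \<open>S\<close>, computed as
  vertices minus edges plus faces of its cell structure (glued vertices, glued edges, regions).
  A region without boundary edges is a surface by itself, namely a sphere, which has
  Euler characteristic 2.\<close>
definition surface_euler_char ::
  "nat \<Rightarrow> (nat \<Rightarrow> nat) \<Rightarrow> (nat \<Rightarrow> nat) \<Rightarrow> nat set \<Rightarrow> int" where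
  "surface_euler_char n K \<pi> S =
     (if \<exists>i. S = {i} \<and> K i = 0 then 2
      else int (card ((\<Union>i\<in>S. boundary_labels K i) // vertex_gluing n K \<pi>))
         - int (card ((\<Union>i\<in>S. boundary_labels K i) // edge_gluing n K \<pi>))
         + int (card S))"

definition total_euler_char :: "nat \<Rightarrow> (nat \<Rightarrow> nat) \<Rightarrow> (nat \<Rightarrow> nat) \<Rightarrow> int" where
  "total_euler_char n K \<pi> = (\<Sum>S\<in>glued_surfaces n K \<pi>. surface_euler_char n K \<pi> S)"


section \<open>The matrix entries along the boundaries\<close>

text \<open>\<open>a (i, k)\<close> is the \<open>k\<close>-th index of the \<open>i\<close>-th loop; the indices range over the type \<open>'N\<close>.\<close>
definition cyclic_indices :: "nat \<Rightarrow> (nat \<Rightarrow> nat) \<Rightarrow> (nat \<times> nat \<Rightarrow> 'N) set" where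
  "cyclic_indices n K =
     {a \<in> (SIGMA i:{1..n}. {1..K i + 1}) \<rightarrow>\<^sub>E UNIV. \<forall>i\<in>{1..n}. a (i, K i + 1) = a (i, 1)}"

definition entry_sequence ::
  "nat \<Rightarrow> (nat \<Rightarrow> nat) \<Rightarrow> ('a \<Rightarrow> complex^'N^'N) \<Rightarrow> (nat \<times> nat \<Rightarrow> 'N) \<Rightarrow> nat \<Rightarrow> 'a \<Rightarrow> complex" where
  "entry_sequence n K W a p \<omega> =
     (let i = region_of n K p; k = p - label_offset K i
      in W \<omega> $ a (i, k) $ a (i, k + 1))"

end

theory Submission
  imports Defs
begin

text \<open>The completeness relation of an orthonormal basis gives
  \<open>E[W\<^sub>a\<^sub>b * W\<^sub>c\<^sub>d] = - 1 / N\<close> if \<open>a = d\<close> and \<open>b = c\<close>, and \<open>0\<close> otherwise. Hence a choice of indices contributes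
  \<open>(- 1 / N) ^ card \<Sigma>\<close> if it is constant on the glued vertices, and \<open>0\<close> otherwise, so the sum is
  \<open>(- 1 / N) ^ card \<Sigma> * N ^ (v + z)\<close>, where \<open>v\<close> is the number of glued vertices and \<open>z\<close> the number of
  regions without boundary edges, each of which carries one free index. On the other hand, there are
  \<open>card \<Sigma>\<close> glued edges and \<open>n\<close> regions, and the spheres count one more than their cells,
  so \<open>\<chi> = v - card \<Sigma> + n + z\<close>.\<close>

section \<open>Covariance of the matrix entries\<close>

lemma u_inner_eq_sum:
  fixes X Y :: "complex^'N^'N"
  shows "u_inner X Y = of_nat CARD('N) * (\<Sum>i\<in>UNIV. \<Sum>k\<in>UNIV. cnj (X $ k $ i) * Y $ k $ i)"
  by (simp add: u_inner_def trace_def matrix_matrix_mult_def hermitian_adjoint_def)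

lemma u_inner_add_right: "u_inner X (Y + Z) = u_inner X Y + u_inner X Z"
  by (simp add: u_inner_eq_sum sum.distrib ring_distribs)

lemma u_inner_scale_right: "u_inner X (\<chi> a b. c * Y $ a $ b) = c * u_inner X Y"
  by (simp add: u_inner_eq_sum sum_distrib_left mult_ac)

lemma u_inner_zero_right: "u_inner X 0 = 0"
  by (simp add: u_inner_eq_sum)

lemma u_inner_scaleR_right: "u_inner X (c *\<^sub>R Y) = c *\<^sub>R u_inner X Y"
  by (simp add: u_inner_eq_sum scaleR_sum_right sum_distrib_left mult_ac)

text \<open>Both sides are real-linear in \<open>A\<close>, and on the basis matrices the equation
  is orthonormality; since \<open>A\<close> lies in the real span, this suffices. The coefficients
  are complex numbers only because \<open>u_inner\<close> is complex-valued.\<close>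

lemma u_expansion_skew:
  assumes "u_orthonormal_basis J X" "A \<in> u_algebra"
  shows "A $ a $ b = (\<Sum>j\<in>J. u_inner (X j) A * X j $ a $ b)"
proof -
  have J: "finite J" "\<And>i j. i \<in> J \<Longrightarrow> j \<in> J \<Longrightarrow> u_inner (X i) (X j) = (if i = j then 1 else 0)"
    and "A \<in> span (X ` J)"
    using assms by (auto simp: u_orthonormal_basis_def)
  from this(3) show ?thesis
  proof (induction rule: span_induct)
    case base
    show ?case
      unfolding subspace_def
      by (auto simp: u_inner_zero_right u_inner_add_right u_inner_scaleR_right
          sum.distrib ring_distribs scaleR_sum_right)
  next
    case (step A)
    then obtain i where "i \<in> J" "A = X i" by blast
    have "(\<Sum>j\<in>J. u_inner (X j) (X i) * X j $ a $ b) = (\<Sum>j\<in>J. if j = i then X i $ a $ b else 0)"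
      using J(2) \<open>i \<in> J\<close> by (intro sum.cong) auto
    then show ?case
      using J(1) \<open>i \<in> J\<close> \<open>A = X i\<close> by (simp add: sum.delta)
  qed
qed

text \<open>The complexification of \<open>u_algebra\<close> is the space of all complex matrices.\<close>
lemma u_expansion:
  fixes X :: "'j \<Rightarrow> complex^'N^'N"
  assumes "u_orthonormal_basis J X"
  shows "A $ a $ b = (\<Sum>j\<in>J. u_inner (X j) A * X j $ a $ b)"
proof -
  \<comment> \<open>\<open>S\<close> is the skew-Hermitian part of \<open>A\<close>, and
    \<open>T\<close> is \<open>- \<i>\<close> times the Hermitian part, which is again
    skew-Hermitian. Hence \<open>A = S + \<i> T\<close>, and the skew-Hermitian expansion applies to
    each summand.\<close>
  define S :: "complex^'N^'N" where "S = (\<chi> a b. (A $ a $ b - cnj (A $ b $ a)) / 2)"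
  define T :: "complex^'N^'N" where "T = (\<chi> a b. - \<i> * (A $ a $ b + cnj (A $ b $ a)) / 2)"
  have S: "S \<in> u_algebra" and T: "T \<in> u_algebra"
    by (simp_all add: u_algebra_def S_def T_def hermitian_adjoint_def vec_eq_iff field_simps)
  have A: "A = S + (\<chi> a b. \<i> * T $ a $ b)"
    by (simp add: S_def T_def vec_eq_iff field_simps)
  have "A $ a $ b = S $ a $ b + \<i> * T $ a $ b"
    by (subst A) simp
  also have "\<dots> = (\<Sum>j\<in>J. u_inner (X j) S * X j $ a $ b)
      + \<i> * (\<Sum>j\<in>J. u_inner (X j) T * X j $ a $ b)"
    by (simp flip: u_expansion_skew[OF assms S] u_expansion_skew[OF assms T])
  also have "\<dots> = (\<Sum>j\<in>J. u_inner (X j) A * X j $ a $ b)"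
  proof -
    have "u_inner (X j) A = u_inner (X j) S + \<i> * u_inner (X j) T" for j
      by (subst A) (simp add: u_inner_add_right u_inner_scale_right)
    then show ?thesis
      by (simp add: sum.distrib sum_distrib_left ring_distribs mult_ac)
  qed
  finally show ?thesis .
qed

text \<open>This is the expansion of a single matrix unit, read off at the entry
  \<open>(a, b)\<close>. The minus sign comes from skew-Hermitian symmetry, the denominator from the
  factor \<open>N\<close> in the inner product.\<close>

lemma u_completeness:
  fixes X :: "'j \<Rightarrow> complex^'N^'N"
  assumes X: "u_orthonormal_basis J X"
  shows "(\<Sum>j\<in>J. X j $ a $ b * X j $ c $ d) = (if a = d \<and> b = c then - 1 / of_nat CARD('N) else 0)"
proof -
  \<comment> \<open>The unit sits at the transposed position \<open>(d, c)\<close>: pairing with it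
    yields \<open>cnj (X j $ d $ c)\<close>, which skew-Hermitian symmetry turns into the wanted
    entry \<open>- X j $ c $ d\<close>.\<close>
  define U :: "complex^'N^'N" where "U = (\<chi> p q. if p = d \<and> q = c then 1 else 0)"
  have inner: "u_inner (X j) U = - of_nat CARD('N) * X j $ c $ d" if "j \<in> J" for j
  proof -
    have "X j \<in> u_algebra"
      using X that by (auto simp: u_orthonormal_basis_def intro: span_base)
    then have adj: "cnj (X j $ d $ c) = - X j $ c $ d"
      unfolding u_algebra_def hermitian_adjoint_def
      by (simp add: vec_eq_iff)
    have "(\<Sum>i\<in>UNIV. \<Sum>k\<in>UNIV. cnj (X j $ k $ i) * U $ k $ i)
      = (\<Sum>i\<in>UNIV. \<Sum>k\<in>UNIV. if k = d then if i = c then cnj (X j $ k $ i) else 0 else 0)"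
      by (intro sum.cong refl) (simp add: U_def)
    also have "\<dots> = cnj (X j $ d $ c)"
      by simp
    finally show ?thesis
      by (simp add: u_inner_eq_sum adj)
  qed
  have "(if a = d \<and> b = c then 1 else 0) = U $ a $ b"
    by (simp add: U_def)
  also have "\<dots> = (\<Sum>j\<in>J. u_inner (X j) U * X j $ a $ b)"
    by (rule u_expansion[OF X])
  also have "\<dots> = - of_nat CARD('N) * (\<Sum>j\<in>J. X j $ a $ b * X j $ c $ d)"
    by (simp add: inner sum_distrib_left mult_ac cong: sum.cong)
  finally have "(\<Sum>j\<in>J. X j $ a $ b * X j $ c $ d)
    = - (if a = d \<and> b = c then 1 else 0) / of_nat CARD('N)"
    by simp
  then show ?thesis
    by simp
qed

text \<open>On the diagonal this is the variance of a standard normal variable; off the diagonal the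
  expectation factorizes by independence and the means vanish. The form with
  \<open>has_bochner_integral\<close> also records integrability, which is needed to exchange
  expectation and sums.\<close>

lemma (in prob_space) std_normal_covariance:
  assumes "\<And>j. j \<in> J \<Longrightarrow> distributed M lborel (B j) std_normal_density"
    and indep: "indep_vars (\<lambda>_. borel) B J" and ij: "i \<in> J" "j \<in> J"
  shows "has_bochner_integral M (\<lambda>\<omega>. B i \<omega> * B j \<omega>) (if i = j then 1 else 0)"
proof -
  have D: "distributed M lborel (B i) std_normal_density" "distributed M lborel (B j) std_normal_density"
    using assms by auto
  show ?thesis
  proof (cases "i = j")
    case True
    have "integrable M (\<lambda>\<omega>. (B i \<omega>)\<^sup>2)"
      using distributed_integrable[OF D(1), of "\<lambda>x. x\<^sup>2"] integrable_std_normal_moment[of 2] by simp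
    moreover have "expectation (\<lambda>\<omega>. (B i \<omega>)\<^sup>2) = 1"
      using standard_normal_distributed_variance[OF D(1)]
        standard_normal_distributed_expectation[OF D(1)] by simp
    ultimately show ?thesis
      using True by (simp add: has_bochner_integral_iff power2_eq_square)
  next
    case False
    have int: "integrable M (B k)" if "k \<in> {i, j}" for k
      using that distributed_integrable[OF D(1), of "\<lambda>x. x"] distributed_integrable[OF D(2), of "\<lambda>x. x"]
        integrable_std_normal_moment[of 1] by auto
    have indep': "indep_vars (\<lambda>_. borel) B {i, j}"
      using indep_vars_subset[OF indep] ij by auto
    from indep_vars_integrable[OF _ indep' int] indep_vars_lebesgue_integral[OF _ indep' int]
    show ?thesis
      using False standard_normal_distributed_expectation[OF D(1)]
      by (simp add: has_bochner_integral_iff)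
  qed
qed

text \<open>Expanding both entries in the basis, the covariance of the coordinates leaves only the
  diagonal sum, which the completeness relation evaluates. No complex conjugate appears, so the
  surviving case is \<open>a = d\<close>, \<open>b = c\<close>: the indices match crosswise.\<close>

lemma u_brownian_covariance:
  fixes W :: "'a \<Rightarrow> complex^'N^'N"
  assumes "prob_space M" and W: "u_brownian_at_one M J X B W"
  shows "(\<integral>\<omega>. W \<omega> $ a $ b * W \<omega> $ c $ d \<partial>M)
    = (if a = d \<and> b = c then - 1 / of_nat CARD('N) else 0)"
proof -
  interpret prob_space M by fact
  have X: "u_orthonormal_basis J X" and "finite J"
    and D: "\<And>j. j \<in> J \<Longrightarrow> distributed M lborel (B j) std_normal_density"
    and indep: "indep_vars (\<lambda>_. borel) B J"
    and W': "\<And>\<omega>. \<omega> \<in> space M \<Longrightarrow> W \<omega> = (\<Sum>j\<in>J. B j \<omega> *\<^sub>R X j)"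
    using W by (auto simp: u_brownian_at_one_def u_orthonormal_basis_def)
  note BB = std_normal_covariance[OF D indep]
  have "(\<integral>\<omega>. W \<omega> $ a $ b * W \<omega> $ c $ d \<partial>M)
    = (\<integral>\<omega>. (\<Sum>i\<in>J. \<Sum>j\<in>J. (B j \<omega> * B i \<omega>) *\<^sub>R (X i $ a $ b * X j $ c $ d)) \<partial>M)"
    \<comment> \<open>The expansion of \<open>W\<close> is known only on \<open>space M\<close>,
      which is enough under the integral.\<close>
    by (intro Bochner_Integration.integral_cong) (simp_all add: W' sum_product)
  also have "\<dots> = (\<Sum>i\<in>J. \<Sum>j\<in>J. (\<integral>\<omega>. B j \<omega> * B i \<omega> \<partial>M) *\<^sub>R (X i $ a $ b * X j $ c $ d))"
    using BB by (simp add: has_bochner_integral_iff)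
  also have "\<dots> = (\<Sum>i\<in>J. \<Sum>j\<in>J. if i = j then X i $ a $ b * X j $ c $ d else 0)"
    using BB by (intro sum.cong refl) (auto simp: has_bochner_integral_iff)
  also have "\<dots> = (\<Sum>i\<in>J. X i $ a $ b * X i $ c $ d)"
    using \<open>finite J\<close> by simp
  finally show ?thesis
    by (simp add: u_completeness[OF X])
qed

section \<open>Equivalence relations on finite sets\<close>

text \<open>Each \<open>B S\<close> is saturated, so no class of \<open>r\<close> meets two
  different blocks, and the quotient of the union is the disjoint union of the quotients.\<close>

lemma card_quotient_partition:
  assumes "finite P" and fin: "\<And>S. S \<in> P \<Longrightarrow> finite (B S)"
    and disj: "\<And>S T. S \<in> P \<Longrightarrow> T \<in> P \<Longrightarrow> S \<noteq> T \<Longrightarrow> B S \<inter> B T = {}"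
    and r: "equiv UNIV r" and sat: "\<And>S x y. S \<in> P \<Longrightarrow> x \<in> B S \<Longrightarrow> (x, y) \<in> r \<Longrightarrow> y \<in> B S"
  shows "card ((\<Union>S\<in>P. B S) // r) = (\<Sum>S\<in>P. card (B S // r))"
proof -
  have "(\<Union>S\<in>P. B S) // r = (\<Union>S\<in>P. B S // r)"
    by (auto simp: quotient_def)
  moreover have "(B S // r) \<inter> (B T // r) = {}" if "S \<in> P" "T \<in> P" "S \<noteq> T" for S T
  proof (rule ccontr)
    assume "(B S // r) \<inter> (B T // r) \<noteq> {}"
    then obtain x y where "x \<in> B S" "y \<in> B T" "r `` {x} = r `` {y}"
      by (auto simp: quotient_def)
    then have "(x, y) \<in> r" using r by (simp add: eq_equiv_class_iff)
    then have "y \<in> B S" using sat that \<open>x \<in> B S\<close> by blast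
    with \<open>y \<in> B T\<close> disj that show False by blast
  qed
  moreover have "finite (B S // r)" if "S \<in> P" for S
    using fin[OF that] by (simp add: quotient_def)
  ultimately show ?thesis
    using \<open>finite P\<close> by (simp add: card_UN_disjoint)
qed

text \<open>A function constant on the classes is the same as a function on the quotient. One
  direction composes with the class map, the other evaluates at a chosen representative.\<close>

lemma card_class_functions:
  assumes "finite A" and r: "equiv UNIV r" and sat: "\<And>x y. x \<in> A \<Longrightarrow> (x, y) \<in> r \<Longrightarrow> y \<in> A"
  shows "card {f \<in> A \<rightarrow>\<^sub>E (UNIV :: 'b::finite set). \<forall>(x, y)\<in>r. f x = f y} = CARD('b) ^ card (A // r)"
proof -
  let ?R = "{f \<in> A \<rightarrow>\<^sub>E (UNIV :: 'b set). \<forall>(x, y)\<in>r. f x = f y}"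
  \<comment> \<open>The representative is chosen from the whole class; saturation places it in
    \<open>A\<close>.\<close>
  have cls: "(SOME x. x \<in> c) \<in> A \<and> r `` {SOME x. x \<in> c} = c" if "c \<in> A // r" for c
  proof -
    from that obtain x where x: "x \<in> A" "c = r `` {x}" by (auto simp: quotient_def)
    then have "x \<in> c" using equiv_class_self[OF r] by simp
    then have "(SOME x. x \<in> c) \<in> c" by (rule someI)
    with x have "(x, SOME x. x \<in> c) \<in> r" by simp
    with x sat r show ?thesis by (simp add: equiv_class_eq)
  qed
  have "bij_betw (\<lambda>g. \<lambda>x\<in>A. g (r `` {x})) (A // r \<rightarrow>\<^sub>E UNIV) ?R"
  proof (rule bij_betw_byWitness[where f' = "\<lambda>f. \<lambda>c\<in>A // r. f (SOME x. x \<in> c)"])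
    show "\<forall>g\<in>A // r \<rightarrow>\<^sub>E (UNIV :: 'b set). (\<lambda>c\<in>A // r. (\<lambda>x\<in>A. g (r `` {x})) (SOME x. x \<in> c)) = g"
    proof (intro ballI ext)
      fix g :: "'a set \<Rightarrow> 'b" and c assume g: "g \<in> A // r \<rightarrow>\<^sub>E UNIV"
      show "(\<lambda>c\<in>A // r. (\<lambda>x\<in>A. g (r `` {x})) (SOME x. x \<in> c)) c = g c"
      proof (cases "c \<in> A // r")
        case True
        then show ?thesis using cls[OF True] by simp
      next
        case False
        then show ?thesis using PiE_arb[OF g False] by simp
      qed
    qed
    show "\<forall>f\<in>?R. (\<lambda>x\<in>A. (\<lambda>c\<in>A // r. f (SOME x. x \<in> c)) (r `` {x})) = f"
    proof (intro ballI ext)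
      fix f x assume f: "f \<in> ?R"
      show "(\<lambda>x\<in>A. (\<lambda>c\<in>A // r. f (SOME x. x \<in> c)) (r `` {x})) x = f x"
      proof (cases "x \<in> A")
        case True
        then have q: "r `` {x} \<in> A // r" by (rule quotientI)
        then have "(x, SOME y. y \<in> r `` {x}) \<in> r"
          using cls[OF q] r by (metis eq_equiv_class_iff UNIV_I)
        with f True q show ?thesis by auto
      next
        case False
        from f have "f \<in> A \<rightarrow>\<^sub>E UNIV" by simp
        from PiE_arb[OF this False] False show ?thesis by simp
      qed
    qed
    show "(\<lambda>g. \<lambda>x\<in>A. g (r `` {x})) ` (A // r \<rightarrow>\<^sub>E UNIV) \<subseteq> ?R"
    proof (intro image_subsetI CollectI conjI)
      fix g :: "'a set \<Rightarrow> 'b"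
      show "(\<lambda>x\<in>A. g (r `` {x})) \<in> A \<rightarrow>\<^sub>E UNIV" by simp
      \<comment> \<open>The pairs range over all of \<open>r\<close>, not only over
        \<open>A\<close>. Saturation, used in both directions, puts \<open>x\<close> and
        \<open>y\<close> both inside \<open>A\<close> or both outside, where both values are
        \<open>undefined\<close>.\<close>
      have "(\<lambda>x\<in>A. g (r `` {x})) x = (\<lambda>x\<in>A. g (r `` {x})) y" if "(x, y) \<in> r" for x y
      proof -
        have "(y, x) \<in> r" "r `` {x} = r `` {y}"
          using r that equiv_class_eq[OF r that] by (auto simp: equiv_def dest: symD)
        then show ?thesis using sat that by (simp add: restrict_def)
      qed
      then show "\<forall>(x, y)\<in>r. (\<lambda>x\<in>A. g (r `` {x})) x = (\<lambda>x\<in>A. g (r `` {x})) y"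
        by blast
    qed
    show "(\<lambda>f. \<lambda>c\<in>A // r. f (SOME x. x \<in> c)) ` ?R \<subseteq> A // r \<rightarrow>\<^sub>E UNIV"
      by auto
  qed
  then have "card ?R = card (A // r \<rightarrow>\<^sub>E (UNIV :: 'b set))"
    by (rule bij_betw_same_card[symmetric])
  also have "\<dots> = CARD('b) ^ card (A // r)"
    using \<open>finite A\<close> by (simp add: card_PiE quotient_def)
  finally show ?thesis .
qed

lemma equiv_equivclp: "equiv UNIV {(x, y). equivclp R x y}"
  by (auto simp: equiv_def refl_on_def sym_def trans_def intro: equivclp_sym equivclp_trans)

text \<open>Induction along a chain of forward and backward steps. With a membership predicate as
  \<open>f\<close>, this shows that classes do not leave a given set.\<close>

lemma equivclp_invariant:
  assumes "equivclp R x y" and "\<And>x y. R x y \<Longrightarrow> f x = f y"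
  shows "f x = f y"
  using assms(1) by (induction rule: equivclp_induct) (auto dest: assms(2))

section \<open>Labels on the boundaries\<close>

lemma label_offset_Suc: "1 \<le> i \<Longrightarrow> label_offset K (Suc i) = label_offset K i + K i"
  by (simp add: label_offset_def atLeastLessThanSuc)

lemma label_offset_mono: "i \<le> j \<Longrightarrow> label_offset K i \<le> label_offset K j"
  unfolding label_offset_def by (intro sum_mono2) auto

lemma label_offset_less:
  assumes "1 \<le> i" "i < j" shows "label_offset K i + K i \<le> label_offset K j"
  using label_offset_mono[of "Suc i" j K] assms by (simp add: label_offset_Suc)

text \<open>The blocks of labels are consecutive intervals. Numbering from 1 matters: the offsets of
  0 and 1 are both 0, so a block with number 0 could overlap the first one.\<close>

lemma boundary_labels_unique:
  assumes "p \<in> boundary_labels K i" "p \<in> boundary_labels K j" "1 \<le> i" "1 \<le> j"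
  shows "i = j"
  using assms label_offset_less[of i j K] label_offset_less[of j i K]
  by (cases i j rule: linorder_cases) (auto simp: boundary_labels_def)

lemma finite_boundary_labels [simp]: "finite (boundary_labels K i)"
  by (simp add: boundary_labels_def)

lemma finite_all_labels [simp]: "finite (all_labels n K)"
  by (simp add: all_labels_def)

text \<open>The consecutive blocks tile an initial segment. This identifies the labels used for
  gluing with the domain of the pairing.\<close>

lemma all_labels_eq: "all_labels n K = {1..\<Sum>i\<in>{1..n}. K i}"
proof (induction n)
  case (Suc n)
  have "all_labels (Suc n) K = all_labels n K \<union> boundary_labels K (Suc n)"
    by (simp add: all_labels_def atLeastAtMostSuc_conv Un_commute)
  also have "boundary_labels K (Suc n) = {(\<Sum>i\<in>{1..n}. K i) <.. (\<Sum>i\<in>{1..n}. K i) + K (Suc n)}"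
    by (simp only: boundary_labels_def label_offset_def atLeastLessThanSuc_atLeastAtMost)
  also have "all_labels n K \<union> \<dots> = {1..\<Sum>i\<in>{1..Suc n}. K i}"
    unfolding Suc.IH by (auto simp: sum.cl_ivl_Suc)
  finally show ?case .
qed (simp add: all_labels_def)

lemma region_of_eq:
  assumes "i \<in> {1..n}" "p \<in> boundary_labels K i" shows "region_of n K p = i"
  unfolding region_of_def using assms by (intro the_equality) (auto intro: boundary_labels_unique)

lemma region_of:
  assumes "p \<in> all_labels n K"
  shows "region_of n K p \<in> {1..n}" "p \<in> boundary_labels K (region_of n K p)"
  using assms region_of_eq by (fastforce simp: all_labels_def)+

lemma next_label:
  assumes "p \<in> all_labels n K"
  shows "next_label n K p \<in> all_labels n K" "region_of n K (next_label n K p) = region_of n K p"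
proof -
  let ?i = "region_of n K p"
  have i: "?i \<in> {1..n}" "next_label n K p \<in> boundary_labels K ?i"
    using region_of[OF assms] by (auto simp: next_label_def Let_def boundary_labels_def)
  then show "next_label n K p \<in> all_labels n K"
    by (auto simp: all_labels_def)
  show "region_of n K (next_label n K p) = ?i"
    using i by (rule region_of_eq)
qed

section \<open>Index choices as functions on the boundary vertices\<close>

definition index_of_label :: "nat \<Rightarrow> (nat \<Rightarrow> nat) \<Rightarrow> (nat \<times> nat \<Rightarrow> 'b) \<Rightarrow> nat \<Rightarrow> 'b" where
  "index_of_label n K a p = a (region_of n K p, p - label_offset K (region_of n K p))"

text \<open>\<open>index_of_label\<close> is the row index of the matrix entry on the edge starting
  at \<open>p\<close>. The closing condition on \<open>a\<close> covers the last edge of each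
  boundary, so the column index is the row index at the next vertex, and the sum over indices
  becomes a sum over functions on vertices.\<close>

lemma index_of_next_label:
  assumes "a \<in> cyclic_indices n K" "p \<in> all_labels n K"
  shows "index_of_label n K a (next_label n K p)
    = a (region_of n K p, Suc (p - label_offset K (region_of n K p)))"
proof -
  define i where "i = region_of n K p"
  have i: "i \<in> {1..n}" "p \<in> boundary_labels K i" and next_i: "region_of n K (next_label n K p) = i"
    using region_of[OF assms(2)] next_label(2)[OF assms(2)] by (auto simp: i_def)
  have per: "a (i, Suc (K i)) = a (i, 1)"
    using assms(1) i(1) by (auto simp: cyclic_indices_def)
  obtain k where k: "p = label_offset K i + k" "1 \<le> k" "k \<le> K i"
    using i(2) by (auto simp: boundary_labels_def intro: that[of "p - label_offset K i"])
  have "next_label n K p = (if k = K i then label_offset K i + 1 else label_offset K i + k + 1)"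
    unfolding next_label_def Let_def i_def[symmetric] using k by simp
  then show ?thesis
    unfolding index_of_label_def next_i i_def[symmetric] using k per by auto
qed

text \<open>A region with boundary edges has one index per vertex, the last index repeating the
  first. A region with \<open>K i = 0\<close> has no vertices, yet its single index
  \<open>a (i, 1)\<close> remains free; the second component keeps it.\<close>

lemma bij_betw_cyclic_indices:
  "bij_betw (\<lambda>a. (\<lambda>p\<in>all_labels n K. index_of_label n K a p, \<lambda>i\<in>{i \<in> {1..n}. K i = 0}. a (i, 1)))
     (cyclic_indices n K :: (nat \<times> nat \<Rightarrow> 'b) set)
     ((all_labels n K \<rightarrow>\<^sub>E UNIV) \<times> ({i \<in> {1..n}. K i = 0} \<rightarrow>\<^sub>E UNIV))"
  (is "bij_betw ?h _ (?F \<times> ?G)")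
proof -
  let ?D = "SIGMA i:{1..n}. {1..K i + 1}"
  \<comment> \<open>The closing index \<open>K i + 1\<close> reads the first label of its block. The
    case \<open>K i = 0\<close> comes first because there \<open>k = 1\<close> is already the
    closing index and no label exists.\<close>
  define inv :: "(nat \<Rightarrow> 'b) \<times> (nat \<Rightarrow> 'b) \<Rightarrow> nat \<times> nat \<Rightarrow> 'b" where
    "inv = (\<lambda>(f, g). \<lambda>(i, k)\<in>?D. if K i = 0 then g i
       else f (label_offset K i + (if k = K i + 1 then 1 else k)))"
  have lab: "label_offset K i + k \<in> boundary_labels K i" "label_offset K i + k \<in> all_labels n K"
    "region_of n K (label_offset K i + k) = i" if "i \<in> {1..n}" "1 \<le> k" "k \<le> K i" for i k
  proof -
    show *: "label_offset K i + k \<in> boundary_labels K i" using that by (simp add: boundary_labels_def)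
    then show "label_offset K i + k \<in> all_labels n K" using that by (auto simp: all_labels_def)
    show "region_of n K (label_offset K i + k) = i" using that(1) * by (rule region_of_eq)
  qed
  have inv_out: "inv fg x = undefined" if "x \<notin> ?D" for fg x
    using that by (cases fg) (simp add: inv_def)
  show ?thesis
  proof (rule bij_betw_byWitness[where f' = inv])
    show "\<forall>a\<in>cyclic_indices n K. inv (?h a) = a"
    proof (intro ballI ext, clarify)
      fix a :: "nat \<times> nat \<Rightarrow> 'b" and i k assume a: "a \<in> cyclic_indices n K"
      then have per: "i \<in> {1..n} \<Longrightarrow> a (i, K i + 1) = a (i, 1)" and "a \<in> ?D \<rightarrow>\<^sub>E UNIV"
        unfolding cyclic_indices_def by blast+
      from PiE_arb[OF this(2)] have out: "(i, k) \<notin> ?D \<Longrightarrow> a (i, k) = undefined" .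
      show "inv (?h a) (i, k) = a (i, k)"
      proof (cases "(i, k) \<in> ?D")
        case True
        then consider "K i = 0" "k = 1" | "K i \<noteq> 0" "k = K i + 1" | "K i \<noteq> 0" "k \<le> K i" by force
        then show ?thesis
          using True per lab[of i 1] lab[of i k]
          by cases (auto simp: inv_def index_of_label_def)
      next
        case False
        show ?thesis unfolding inv_out[OF False] out[OF False] ..
      qed
    qed
    show "\<forall>x\<in>?F \<times> ?G. ?h (inv x) = x"
    proof
      fix x assume "x \<in> ?F \<times> ?G"
      then obtain f g where x: "x = (f, g)" and f: "f \<in> ?F" and g: "g \<in> ?G"
        by (rule SigmaE)
      have "(\<lambda>p\<in>all_labels n K. index_of_label n K (inv (f, g)) p) p = f p" for p
      proof (cases "p \<in> all_labels n K")
        case True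
        define i where "i = region_of n K p"
        have "i \<in> {1..n}" "p \<in> boundary_labels K i"
          using region_of[OF True] by (auto simp: i_def)
        then show ?thesis
          using True by (auto simp: index_of_label_def inv_def boundary_labels_def simp flip: i_def)
      next
        case False
        then show ?thesis using PiE_arb[OF f] by simp
      qed
      moreover have "(\<lambda>i\<in>{i \<in> {1..n}. K i = 0}. inv (f, g) (i, 1)) i = g i" for i
      proof (cases "i \<in> {i \<in> {1..n}. K i = 0}")
        case True
        then show ?thesis by (simp add: inv_def)
      next
        case False
        then show ?thesis using PiE_arb[OF g False] by (simp only: restrict_apply if_False)
      qed
      ultimately show "?h (inv x) = x"
        unfolding x prod.inject by (intro conjI ext)
    qed
    show "?h ` cyclic_indices n K \<subseteq> ?F \<times> ?G"
      by (intro image_subsetI SigmaI) simp_all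
    show "inv ` (?F \<times> ?G) \<subseteq> cyclic_indices n K"
    proof (intro image_subsetI)
      fix fg :: "(nat \<Rightarrow> 'b) \<times> (nat \<Rightarrow> 'b)" assume "fg \<in> ?F \<times> ?G"
      have "inv fg \<in> ?D \<rightarrow>\<^sub>E UNIV"
        by (intro PiE_I UNIV_I inv_out)
      moreover have "inv fg (i, K i + 1) = inv fg (i, 1)" if "i \<in> {1..n}" for i
        using that by (cases fg) (simp add: inv_def)
      ultimately show "inv fg \<in> cyclic_indices n K"
        unfolding cyclic_indices_def mem_Collect_eq by (intro conjI ballI)
    qed
  qed
qed

section \<open>Gluing along a pairing of the edges\<close>

text \<open>This separates the combinatorics of gluing from the origin of the pairing: the lassos
  and the points enter only through these assumptions.\<close>

locale edge_pairing =
  fixes n :: nat and K :: "nat \<Rightarrow> nat" and \<pi> :: "nat \<Rightarrow> nat" and k :: nat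
  assumes sum_K: "(\<Sum>i\<in>{1..n}. K i) = 2 * k"
    and pairing_in: "\<And>p. p \<in> {1..2 * k} \<Longrightarrow> \<pi> p \<in> {1..2 * k}"
    and pairing_involution: "\<And>p. p \<in> {1..2 * k} \<Longrightarrow> \<pi> (\<pi> p) = p"
    and pairing_neq: "\<And>p. p \<in> {1..2 * k} \<Longrightarrow> \<pi> p \<noteq> p"
begin

section \<open>The 2-cycles of the pairing and the glued edges\<close>

abbreviation "labels \<equiv> all_labels n K"
abbreviation "empty_regions \<equiv> {i \<in> {1..n}. K i = 0}"

text \<open>The index set of the product in \<open>wick_product\<close>, with one element for each
  2-cycle of \<open>\<pi>\<close>.\<close>

definition pairs :: "(nat \<times> nat) set" where
  "pairs = {(p, q). p \<in> {1..2 * k} \<and> q \<in> {1..2 * k} \<and> p < q \<and> \<pi> p = q}"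

lemma labels_eq: "labels = {1..2 * k}"
  unfolding all_labels_eq sum_K ..

lemma pairing_labels:
  assumes "p \<in> labels" shows "\<pi> p \<in> labels" "\<pi> (\<pi> p) = p" "\<pi> p \<noteq> p"
  using assms pairing_in pairing_involution pairing_neq unfolding labels_eq by blast+

lemma finite_pairs: "finite pairs"
  by (rule finite_subset[of _ "{1..2 * k} \<times> {1..2 * k}"]) (auto simp: pairs_def)

text \<open>The smaller and the larger members of the 2-cycles split the \<open>2 * k\<close>
  labels, and each projection is injective on \<open>pairs\<close>.\<close>

lemma card_pairs: "card pairs = k"
proof -
  have inj: "inj_on fst pairs" "inj_on snd pairs"
  proof -
    show "inj_on fst pairs" by (auto simp: inj_on_def pairs_def)
    show "inj_on snd pairs"
    proof (rule inj_onI)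
      fix x y assume "x \<in> pairs" "y \<in> pairs" "snd x = snd y"
      then show "x = y" using pairing_involution[of "fst x"] pairing_involution[of "fst y"] by (auto simp: pairs_def)
    qed
  qed
  have disj: "fst ` pairs \<inter> snd ` pairs = {}"
  proof (rule ccontr)
    assume "fst ` pairs \<inter> snd ` pairs \<noteq> {}"
    then obtain x y where "x \<in> pairs" "y \<in> pairs" "fst x = snd y" by blast
    then show False using pairing_involution[of "fst y"] by (auto simp: pairs_def)
  qed
  have "p \<in> fst ` pairs \<union> snd ` pairs" if "p \<in> {1..2 * k}" for p
  proof (cases "p < \<pi> p")
    case True
    then have "(p, \<pi> p) \<in> pairs" using that pairing_in[OF that] by (simp add: pairs_def)
    from imageI[OF this, of fst] show ?thesis by simp
  next
    case False
    then have "(\<pi> p, p) \<in> pairs"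
      using that pairing_in[OF that] pairing_involution[OF that] pairing_neq[OF that] by (auto simp: pairs_def)
    from imageI[OF this, of snd] show ?thesis by simp
  qed
  moreover have "fst ` pairs \<union> snd ` pairs \<subseteq> {1..2 * k}"
    by (auto simp: pairs_def)
  ultimately have "{1..2 * k} = fst ` pairs \<union> snd ` pairs"
    by blast
  then have "card {1..2 * k} = card (fst ` pairs) + card (snd ` pairs)"
    using disj finite_pairs by (simp add: card_Un_disjoint)
  then show ?thesis
    by (simp add: card_image[OF inj(1)] card_image[OF inj(2)])
qed

text \<open>Because \<open>\<pi>\<close> is an involution, \<open>{p, \<pi> p}\<close> is closed
  under the generating relation in both directions, so the generated class cannot be larger.\<close>

lemma edge_class:
  assumes "p \<in> labels" shows "edge_gluing n K \<pi> `` {p} = {p, \<pi> p}"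
proof -
  have "q \<in> {p, \<pi> p} \<longleftrightarrow> p \<in> {p, \<pi> p}" if "(p, q) \<in> edge_gluing n K \<pi>" for q
  proof -
    have "(\<lambda>x. x \<in> {p, \<pi> p}) p = (\<lambda>x. x \<in> {p, \<pi> p}) q"
      using that unfolding edge_gluing_def mem_Collect_eq prod.case
      by (rule equivclp_invariant) (metis insert_iff empty_iff pairing_labels(2)[OF assms])
    then show ?thesis by blast
  qed
  moreover have "(p, \<pi> p) \<in> edge_gluing n K \<pi>"
    using assms pairing_labels[OF assms] by (auto simp: edge_gluing_def)
  ultimately show ?thesis
    by (auto simp: edge_gluing_def)
qed

text \<open>Without fixed points every class has two elements, so the \<open>2 * k\<close> labels
  form \<open>k\<close> glued edges.\<close>

lemma card_edges: "card (labels // edge_gluing n K \<pi>) = k"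
proof -
  let ?Q = "labels // edge_gluing n K \<pi>"
  have Q: "?Q = (\<lambda>p. {p, \<pi> p}) ` labels"
    unfolding quotient_def using edge_class by auto
  have U: "\<Union> ?Q = labels"
    unfolding Q using pairing_labels(1) by blast
  have "2 * card ?Q = card (\<Union> ?Q)"
  proof (rule card_partition)
    show "finite ?Q" by (simp add: Q)
    show "finite (\<Union> ?Q)" by (simp add: U)
    show "card c = 2" if "c \<in> ?Q" for c
    proof -
      obtain p where "p \<in> labels" "c = {p, \<pi> p}" using \<open>c \<in> ?Q\<close> unfolding Q by blast
      then show ?thesis using pairing_labels(3)[of p] by simp
    qed
    show "c \<inter> d = {}" if "c \<in> ?Q" "d \<in> ?Q" "c \<noteq> d" for c d
      using quotient_disj[OF equiv_equivclp, of c _ d] that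
      unfolding edge_gluing_def quotient_def by blast
  qed
  also have "\<dots> = 2 * k"
    unfolding U by (simp add: labels_eq)
  finally show ?thesis by simp
qed

section \<open>Splitting the glued vertices and edges among the surfaces\<close>

lemma vertex_gluing_equiv: "equiv UNIV (vertex_gluing n K \<pi>)"
  unfolding vertex_gluing_def by (rule equiv_equivclp)

lemma edge_gluing_equiv: "equiv UNIV (edge_gluing n K \<pi>)"
  unfolding edge_gluing_def by (rule equiv_equivclp)

lemma region_gluing_equiv: "equiv UNIV (region_gluing n K \<pi>)"
  unfolding region_gluing_def by (rule equiv_equivclp)

lemma region_gluing_range:
  assumes "(i, j) \<in> region_gluing n K \<pi>" shows "i \<in> {1..n} \<longleftrightarrow> j \<in> {1..n}"
proof -
  have "(\<lambda>i. i \<in> {1..n}) i = (\<lambda>i. i \<in> {1..n}) j"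
    using assms unfolding region_gluing_def mem_Collect_eq prod.case
    by (rule equivclp_invariant) auto
  then show ?thesis .
qed

lemma region_gluing_pairing:
  assumes "p \<in> labels"
  shows "(region_of n K p, region_of n K (\<pi> p)) \<in> region_gluing n K \<pi>"
proof -
  have "\<pi> p \<in> labels" "\<pi> (\<pi> p) = p" using pairing_labels[OF assms] by auto
  with region_of[OF assms] region_of[OF this(1)] show ?thesis
    unfolding region_gluing_def by blast
qed

text \<open>The surface that contains a label, with \<open>None\<close> for numbers that are not
  labels. The option type makes this an invariant on all naturals, so constancy along a gluing also
  shows that the gluing does not leave the labels.\<close>

definition region_class :: "nat \<Rightarrow> nat set option" where
  "region_class p = (if p \<in> labels then Some (region_gluing n K \<pi> `` {region_of n K p}) else None)"

lemma region_class_pairing: "p \<in> labels \<Longrightarrow> region_class p = region_class (\<pi> p)"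
  using equiv_class_eq[OF region_gluing_equiv region_gluing_pairing, of p]
  by (simp add: region_class_def pairing_labels)

lemma region_class_next: "p \<in> labels \<Longrightarrow> region_class (next_label n K p) = region_class p"
  by (simp add: region_class_def next_label)

text \<open>A generating step combines a step along one boundary with a passage to the matched edge.
  The first stays in the region, the second in the surface.\<close>

lemma region_class_vertex:
  assumes "(x, y) \<in> vertex_gluing n K \<pi>" shows "region_class x = region_class y"
  using assms unfolding vertex_gluing_def mem_Collect_eq prod.case
  by (rule equivclp_invariant) (metis region_class_next region_class_pairing)

lemma region_class_edge:
  assumes "(x, y) \<in> edge_gluing n K \<pi>" shows "region_class x = region_class y"
  using assms unfolding edge_gluing_def mem_Collect_eq prod.case
  by (rule equivclp_invariant) (metis region_class_pairing)

abbreviation "surface_labels \<equiv> \<lambda>S. \<Union>i\<in>S. boundary_labels K i"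

lemma surface_subset: "S \<in> glued_surfaces n K \<pi> \<Longrightarrow> S \<subseteq> {1..n}"
  using region_gluing_range by (auto simp: glued_surfaces_def quotient_def)

lemma surface_disjoint:
  assumes "S \<in> glued_surfaces n K \<pi>" "T \<in> glued_surfaces n K \<pi>" "S \<noteq> T"
  shows "S \<inter> T = {}"
  using quotient_disj[OF region_gluing_equiv, of S T] assms
  by (auto simp: glued_surfaces_def quotient_def)

lemma finite_surfaces: "finite (glued_surfaces n K \<pi>)"
  by (simp add: glued_surfaces_def quotient_def)

lemma Union_surfaces: "\<Union> (glued_surfaces n K \<pi>) = {1..n}"
proof -
  have "i \<in> \<Union> (glued_surfaces n K \<pi>)" if "i \<in> {1..n}" for i
    using that equiv_class_self[OF region_gluing_equiv, of i]
    unfolding glued_surfaces_def quotient_def by blast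
  then show ?thesis using surface_subset by blast
qed

text \<open>The labels of a surface are a fibre of \<open>region_class\<close>; disjointness and
  saturation of these sets then follow from the invariance lemmas.\<close>

lemma mem_surface_labels:
  assumes "S \<in> glued_surfaces n K \<pi>"
  shows "x \<in> surface_labels S \<longleftrightarrow> region_class x = Some S"
proof
  assume "x \<in> surface_labels S"
  then obtain i where i: "i \<in> S" "x \<in> boundary_labels K i" by blast
  then have "i \<in> {1..n}" using surface_subset assms by blast
  with i have "x \<in> labels" "region_of n K x = i"
    by (auto simp: all_labels_def intro: region_of_eq)
  moreover have "region_gluing n K \<pi> `` {i} = S"
    using assms i(1) equiv_class_eq[OF region_gluing_equiv]
    by (fastforce simp: glued_surfaces_def quotient_def)
  ultimately show "region_class x = Some S" by (simp add: region_class_def)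
next
  assume "region_class x = Some S"
  then have x: "x \<in> labels" "S = region_gluing n K \<pi> `` {region_of n K x}"
    by (auto simp: region_class_def split: if_splits)
  with equiv_class_self[OF region_gluing_equiv, of "region_of n K x"] region_of(2)[OF x(1)]
  show "x \<in> surface_labels S" by auto
qed

text \<open>Stated for any relation preserving \<open>region_class\<close>, since it serves for the
  glued vertices and for the glued edges.\<close>

lemma card_surface_quotients:
  assumes "equiv UNIV r" and "\<And>x y. (x, y) \<in> r \<Longrightarrow> region_class x = region_class y"
  shows "card (labels // r) = (\<Sum>S\<in>glued_surfaces n K \<pi>. card (surface_labels S // r))"
proof -
  have "labels = (\<Union>S\<in>glued_surfaces n K \<pi>. surface_labels S)"
    unfolding all_labels_def using Union_surfaces by blast
  also have "card (\<dots> // r) = (\<Sum>S\<in>glued_surfaces n K \<pi>. card (surface_labels S // r))"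
  proof (rule card_quotient_partition[OF finite_surfaces _ _ assms(1)])
    show "finite (surface_labels S)" if "S \<in> glued_surfaces n K \<pi>" for S
      using finite_subset[OF surface_subset[OF that]] by simp
    show "surface_labels S \<inter> surface_labels T = {}"
      if "S \<in> glued_surfaces n K \<pi>" "T \<in> glued_surfaces n K \<pi>" "S \<noteq> T" for S T
      using mem_surface_labels[OF that(1)] mem_surface_labels[OF that(2)] that(3)
      by (metis disjoint_iff option.inject)
    show "y \<in> surface_labels S"
      if "S \<in> glued_surfaces n K \<pi>" "x \<in> surface_labels S" "(x, y) \<in> r" for S x y
      using that(2) assms(2)[OF that(3)] unfolding mem_surface_labels[OF that(1)] by simp
  qed
  finally show ?thesis .
qed

text \<open>A region without labels takes part in no generating step of
  \<open>region_gluing\<close>, so its class consists of itself.\<close>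

lemma singleton_surface: "i \<in> empty_regions \<Longrightarrow> {i} \<in> glued_surfaces n K \<pi>"
proof -
  assume i: "i \<in> empty_regions"
  have "j = i" if "(i, j) \<in> region_gluing n K \<pi>" for j
  proof -
    have "(\<lambda>x. x = i) i = (\<lambda>x. x = i) j"
      using that unfolding region_gluing_def mem_Collect_eq prod.case
      by (rule equivclp_invariant) (use i in \<open>auto simp: boundary_labels_def\<close>)
    then show ?thesis by simp
  qed
  then have "region_gluing n K \<pi> `` {i} = {i}"
    using equiv_class_self[OF region_gluing_equiv, of i] by auto
  then show ?thesis using i unfolding glued_surfaces_def quotient_def by blast
qed

section \<open>The total Euler characteristic\<close>

lemma surface_euler_char_eq:
  "surface_euler_char n K \<pi> S
    = int (card (surface_labels S // vertex_gluing n K \<pi>))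
      - int (card (surface_labels S // edge_gluing n K \<pi>))
      + int (card S) + (if S \<in> (\<lambda>i. {i}) ` {i. K i = 0} then 1 else 0)"
  \<comment> \<open>For a sphere there are no labels, so both quotients are empty and
    \<open>card S\<close> is 1; the correction 1 brings the value to 2.\<close>
  by (auto simp: surface_euler_char_def boundary_labels_def)

lemma total_euler_char_eq:
  "total_euler_char n K \<pi>
    = int (card (labels // vertex_gluing n K \<pi>)) - int k + int n + int (card empty_regions)"
proof -
  let ?G = "glued_surfaces n K \<pi>"
  have V: "card (labels // vertex_gluing n K \<pi>) = (\<Sum>S\<in>?G. card (surface_labels S // vertex_gluing n K \<pi>))"
    by (rule card_surface_quotients[OF vertex_gluing_equiv region_class_vertex])
  have E: "card (labels // edge_gluing n K \<pi>) = (\<Sum>S\<in>?G. card (surface_labels S // edge_gluing n K \<pi>))"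
    by (rule card_surface_quotients[OF edge_gluing_equiv region_class_edge])
  have "card (\<Union> ?G) = (\<Sum>S\<in>?G. card S)"
  proof (rule card_Union_disjoint)
    show "pairwise disjnt ?G"
      using surface_disjoint unfolding pairwise_def disjnt_def by blast
    show "finite S" if "S \<in> ?G" for S
      using surface_subset[OF that] by (rule finite_subset) simp
  qed
  then have R: "int n = (\<Sum>S\<in>?G. int (card S))"
    by (simp add: Union_surfaces flip: of_nat_sum)
  \<comment> \<open>The set \<open>{i. K i = 0}\<close> is not bounded by \<open>n\<close>;
    intersecting with the surfaces keeps only genuine regions.\<close>
  have "?G \<inter> (\<lambda>i. {i}) ` {i. K i = 0} = (\<lambda>i. {i}) ` empty_regions"
    using singleton_surface surface_subset by blast
  then have Z: "(\<Sum>S\<in>?G. if S \<in> (\<lambda>i. {i}) ` {i. K i = 0} then 1 else 0 :: int) = int (card empty_regions)"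
    by (simp add: sum.If_cases[OF finite_surfaces] card_image flip: Int_def)
  show ?thesis
    unfolding total_euler_char_def surface_euler_char_eq sum.distrib sum_subtractf Z R
      card_edges[symmetric] V E by simp
qed

section \<open>Index choices that are constant on the glued vertices\<close>

lemma respects_vertex_gluing_iff:
  "(\<forall>(x, y)\<in>vertex_gluing n K \<pi>. restrict f labels x = restrict f labels y)
    \<longleftrightarrow> (\<forall>(p, q)\<in>pairs. f p = f (next_label n K q) \<and> f (next_label n K p) = f q)"
  (is "?L \<longleftrightarrow> ?R")
proof
  assume L: ?L
  have "f p = f (next_label n K q) \<and> f (next_label n K p) = f q" if pq: "(p, q) \<in> pairs" for p q
  proof -
    have *: "p \<in> labels" "q \<in> labels" "\<pi> p = q" "\<pi> q = p" "p \<noteq> q"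
      using pq pairing_involution[of p] by (auto simp: labels_eq pairs_def)
    then have "(p, next_label n K q) \<in> vertex_gluing n K \<pi>" "(next_label n K p, q) \<in> vertex_gluing n K \<pi>"
      unfolding vertex_gluing_def by blast+
    with L have "restrict f labels p = restrict f labels (next_label n K q)"
      "restrict f labels (next_label n K p) = restrict f labels q"
      by blast+
    then show ?thesis using * next_label(1) by simp
  qed
  then show ?R by blast
next
  assume R: ?R
  \<comment> \<open>\<open>pairs\<close> contains each 2-cycle in increasing order only. Exchanging
    \<open>p\<close> and \<open>q\<close> merely exchanges the two equations, so both orders are
    covered.\<close>
  have *: "f p = f (next_label n K q) \<and> f (next_label n K p) = f q"
    if "p \<in> labels" "q \<in> labels" "\<pi> p = q" "\<pi> q = p" "p \<noteq> q" for p q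
  proof (cases "p < q")
    case True
    then have "(p, q) \<in> pairs" using that by (simp add: labels_eq pairs_def)
    with R show ?thesis by blast
  next
    case False
    then have "(q, p) \<in> pairs" using that by (simp add: labels_eq pairs_def)
    with R have "f q = f (next_label n K p) \<and> f (next_label n K q) = f p" by blast
    then show ?thesis by simp
  qed
  have "restrict f labels x = restrict f labels y" if "(x, y) \<in> vertex_gluing n K \<pi>" for x y
    using that unfolding vertex_gluing_def mem_Collect_eq prod.case
  \<comment> \<open>Checking the generators suffices for the generated equivalence; their points are
    labels, so the restriction is invisible there.\<close>
  proof (rule equivclp_invariant, elim bexE conjE)
    fix x y p q
    assume pq: "p \<in> labels" "q \<in> labels" "\<pi> p = q" "\<pi> q = p" "p \<noteq> q"
      and "x = p \<and> y = next_label n K q \<or> x = next_label n K p \<and> y = q"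
    then show "restrict f labels x = restrict f labels y"
      using *[OF pq] next_label(1)[OF pq(1)] next_label(1)[OF pq(2)] pq(1,2)
      by (elim disjE conjE) (simp_all only: restrict_apply if_True)
  qed
  then show ?L by blast
qed

lemma vertex_gluing_labels:
  assumes "x \<in> labels" "(x, y) \<in> vertex_gluing n K \<pi>" shows "y \<in> labels"
  using region_class_vertex[OF assms(2)] assms(1) by (auto simp: region_class_def split: if_splits)

text \<open>The condition that no covariance factor vanishes. The crosswise matching of indices in
  the covariance is the identification of initial with terminal vertices in an orientation-reversing
  gluing.\<close>

definition compatible :: "(nat \<times> nat \<Rightarrow> 'b) \<Rightarrow> bool" where
  "compatible a \<longleftrightarrow> (\<forall>(p, q)\<in>pairs.
     index_of_label n K a p = index_of_label n K a (next_label n K q) \<and>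
     index_of_label n K a (next_label n K p) = index_of_label n K a q)"

text \<open>Under the bijection for cyclic indices, compatibility constrains only the function on
  labels, to be constant on glued vertices. The indices of the empty regions stay free and give the
  second exponent.\<close>

lemma card_compatible_indices:
  "card {a \<in> cyclic_indices n K :: (nat \<times> nat \<Rightarrow> 'b::finite) set. compatible a}
    = CARD('b) ^ (card (labels // vertex_gluing n K \<pi>) + card empty_regions)"
proof -
  let ?F = "{f \<in> labels \<rightarrow>\<^sub>E (UNIV :: 'b set). \<forall>(x, y)\<in>vertex_gluing n K \<pi>. f x = f y}"
  let ?G = "empty_regions \<rightarrow>\<^sub>E (UNIV :: 'b set)"
  let ?h = "\<lambda>a :: nat \<times> nat \<Rightarrow> 'b.
    (\<lambda>p\<in>labels. index_of_label n K a p, \<lambda>i\<in>empty_regions. a (i, 1))"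
  have "bij_betw ?h {a \<in> cyclic_indices n K. compatible a}
      {h \<in> (labels \<rightarrow>\<^sub>E UNIV) \<times> ?G. \<forall>(x, y)\<in>vertex_gluing n K \<pi>. fst h x = fst h y}"
  proof (rule bij_betw_Collect[OF bij_betw_cyclic_indices])
    fix a :: "nat \<times> nat \<Rightarrow> 'b"
    show "(\<forall>(x, y)\<in>vertex_gluing n K \<pi>. fst (?h a) x = fst (?h a) y) \<longleftrightarrow> compatible a"
      unfolding compatible_def fst_conv respects_vertex_gluing_iff ..
  qed
  then have "card {a \<in> cyclic_indices n K :: (nat \<times> nat \<Rightarrow> 'b) set. compatible a}
    = card {h \<in> (labels \<rightarrow>\<^sub>E (UNIV :: 'b set)) \<times> ?G. \<forall>(x, y)\<in>vertex_gluing n K \<pi>. fst h x = fst h y}"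
    by (rule bij_betw_same_card)
  also have "{h \<in> (labels \<rightarrow>\<^sub>E (UNIV :: 'b set)) \<times> ?G. \<forall>(x, y)\<in>vertex_gluing n K \<pi>. fst h x = fst h y}
    = ?F \<times> ?G"
    by auto
  also have "card (?F \<times> ?G) = card ?F * card ?G"
    by (rule card_cartesian_product)
  also have "card ?F = CARD('b) ^ card (labels // vertex_gluing n K \<pi>)"
    by (rule card_class_functions[OF finite_all_labels vertex_gluing_equiv vertex_gluing_labels])
  also have "card ?G = CARD('b) ^ card empty_regions"
    by (simp add: card_PiE)
  finally show ?thesis
    by (simp add: power_add)
qed

section \<open>Evaluation of the Wick products and of their sum\<close>

lemma wick_product_entries:
  fixes W :: "'a \<Rightarrow> complex^'N^'N"
  assumes "prob_space M" "u_brownian_at_one M J X B W" and a: "a \<in> cyclic_indices n K"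
  shows "wick_product M k \<pi> (entry_sequence n K W a)
    = (if compatible a then (- 1 / of_nat CARD('N)) ^ k else 0)"
proof -
  let ?x = "index_of_label n K a" and ?s = "next_label n K" and ?c = "- 1 / complex_of_nat CARD('N)"
  \<comment> \<open>The column index is rewritten as the vertex index at the next label, so that
    each covariance compares indices of vertices.\<close>
  have entry: "entry_sequence n K W a p \<omega> = W \<omega> $ ?x p $ ?x (?s p)" if "p \<in> {1..2 * k}" for p \<omega>
    using index_of_next_label[OF a, of p] that
    by (simp add: labels_eq entry_sequence_def Let_def index_of_label_def)
  have wick: "wick_product M k \<pi> (entry_sequence n K W a)
    = (\<Prod>(p, q)\<in>pairs. if ?x p = ?x (?s q) \<and> ?x (?s p) = ?x q then ?c else 0)"
    unfolding wick_product_def pairs_def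
  proof (intro prod.cong refl, clarify)
    fix p assume "p \<in> {1..2 * k}" "\<pi> p \<in> {1..2 * k}"
    then show "(\<integral>\<omega>. entry_sequence n K W a p \<omega> * entry_sequence n K W a (\<pi> p) \<omega> \<partial>M)
        = (if ?x p = ?x (?s (\<pi> p)) \<and> ?x (?s p) = ?x (\<pi> p) then ?c else 0)"
      by (simp only: entry u_brownian_covariance[OF assms(1,2)])
  qed
  \<comment> \<open>Either all factors equal \<open>- 1 / N\<close>, one for each of the
    \<open>k\<close> pairs, or a single violated matching kills the product.\<close>
  show ?thesis
  proof (cases "compatible a")
    case True
    then have "(\<Prod>(p, q)\<in>pairs. if ?x p = ?x (?s q) \<and> ?x (?s p) = ?x q then ?c else 0) = (\<Prod>_\<in>pairs. ?c)"
      unfolding compatible_def by (intro prod.cong refl) auto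
    also have "\<dots> = ?c ^ k"
      by (simp only: prod_constant card_pairs)
    finally show ?thesis
      unfolding wick if_P[OF True] .
  next
    case False
    from False obtain p q where pq: "(p, q) \<in> pairs" "\<not> (?x p = ?x (?s q) \<and> ?x (?s p) = ?x q)"
      unfolding compatible_def by blast
    have "(\<Prod>(p, q)\<in>pairs. if ?x p = ?x (?s q) \<and> ?x (?s p) = ?x q then ?c else 0) = 0"
      by (rule prod_zero[OF finite_pairs bexI[OF _ pq(1)]]) (simp only: prod.case if_not_P[OF pq(2)])
    then show ?thesis
      unfolding wick if_not_P[OF False] .
  qed
qed

lemma finite_cyclic_indices: "finite (cyclic_indices n K :: (nat \<times> nat \<Rightarrow> 'b::finite) set)"
  unfolding cyclic_indices_def by (rule finite_subset[OF Collect_restrict]) (auto intro!: finite_PiE)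

lemma sum_wick_product:
  fixes W :: "'a \<Rightarrow> complex^'N^'N"
  assumes "prob_space M" "u_brownian_at_one M J X B W"
  shows "(\<Sum>a\<in>cyclic_indices n K. wick_product M k \<pi> (entry_sequence n K W a))
    = (-1) ^ k * of_nat CARD('N) powi (- int n + total_euler_char n K \<pi>)"
proof -
  let ?V = "card (labels // vertex_gluing n K \<pi>)" and ?Z = "card empty_regions"
  let ?N = "of_nat CARD('N) :: complex"
  have "(\<Sum>a\<in>cyclic_indices n K. wick_product M k \<pi> (entry_sequence n K W a))
    = (\<Sum>a\<in>(cyclic_indices n K :: (nat \<times> nat \<Rightarrow> 'N) set). if compatible a then (- 1 / ?N) ^ k else 0)"
    by (intro sum.cong refl wick_product_entries[OF assms])
  also have "\<dots> = (\<Sum>a\<in>{a \<in> cyclic_indices n K :: (nat \<times> nat \<Rightarrow> 'N) set. compatible a}. (- 1 / ?N) ^ k)"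
    by (rule sum.inter_filter[OF finite_cyclic_indices, symmetric])
  also have "\<dots> = of_nat (CARD('N) ^ (?V + ?Z)) * (- 1 / ?N) ^ k"
    unfolding sum_constant card_compatible_indices ..
  also have "\<dots> = (-1) ^ k * (?N ^ (?V + ?Z) / ?N ^ k)"
    unfolding power_divide by simp
  \<comment> \<open>The exponent may be negative, hence the passage to \<open>powi\<close>; the base
    is nonzero as the cardinality of a finite type.\<close>
  also have "?N ^ (?V + ?Z) / ?N ^ k = ?N powi (int (?V + ?Z) - int k)"
    by (simp add: power_int_diff del: of_nat_add)
  also have "int (?V + ?Z) - int k = - int n + total_euler_char n K \<pi>"
    by (simp add: total_euler_char_eq)
  finally show ?thesis .
qed

end

section \<open>The pairing given by a set of points\<close>

text \<open>The rank increases strictly along the order, hence is injective; an injective map into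
  \<open>{1..card A}\<close> is onto by counting. The order is a predicate so that
  \<open>lex_le\<close> can be inserted.\<close>

lemma bij_betw_rank:
  fixes le :: "'b \<Rightarrow> 'b \<Rightarrow> bool"
  assumes "finite A" and refl: "\<And>x. le x x" and trans: "\<And>x y z. le x y \<Longrightarrow> le y z \<Longrightarrow> le x z"
    and antisym: "\<And>x y. le x y \<Longrightarrow> le y x \<Longrightarrow> x = y" and total: "\<And>x y. le x y \<or> le y x"
  shows "bij_betw (\<lambda>x. card {y \<in> A. le y x}) A {1..card A}"
proof -
  let ?r = "\<lambda>x. card {y \<in> A. le y x}"
  have less: "?r x < ?r y" if "x \<in> A" "y \<in> A" "le x y" "x \<noteq> y" for x y
  proof (rule psubset_card_mono)
    have "y \<notin> {z \<in> A. le z x}" "y \<in> {z \<in> A. le z y}"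
      using that refl antisym by blast+
    moreover have "{z \<in> A. le z x} \<subseteq> {z \<in> A. le z y}"
      using trans \<open>le x y\<close> by blast
    ultimately show "{z \<in> A. le z x} \<subset> {z \<in> A. le z y}" by blast
  qed (use \<open>finite A\<close> in simp)
  have inj: "inj_on ?r A"
  proof (rule inj_onI)
    fix x y assume "x \<in> A" "y \<in> A" "?r x = ?r y"
    then show "x = y" using less[of x y] less[of y x] total[of x y] by fastforce
  qed
  have "?r ` A \<subseteq> {1..card A}"
  proof (intro image_subsetI)
    fix x assume "x \<in> A"
    then have "{x} \<subseteq> {y \<in> A. le y x}" "{y \<in> A. le y x} \<subseteq> A"
      using refl by auto
    then have "card {x} \<le> ?r x" "?r x \<le> card A"
      using \<open>finite A\<close> by (auto intro!: card_mono simp del: card.insert)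
    then show "?r x \<in> {1..card A}" by simp
  qed
  then have "?r ` A = {1..card A}"
    using card_image[OF inj] by (intro card_subset_eq) auto
  then show ?thesis using inj by (simp add: bij_betw_def)
qed

lemma bij_betw_mark_label:
  assumes "finite (marks \<Sigma>)"
  shows "bij_betw (mark_label \<Sigma>) (marks \<Sigma>) {1..card (marks \<Sigma>)}"
  unfolding mark_label_def using assms
  by (intro bij_betw_rank) (auto simp: lex_le_def prod_eq_iff)

locale point_configuration =
  fixes n :: nat and w :: "nat \<Rightarrow> lasso_word" and \<Sigma> :: "pair_point set"
  assumes finite_points: "finite \<Sigma>" and points: "\<Sigma> \<subseteq> pair_space n w"
    and disjoint: "disjoint_marks \<Sigma>"
begin

lemma point_cases:
  assumes "z \<in> \<Sigma>"
  obtains m m' t where "z = ((m, m'), t)" "1 \<le> m" "m < m'" "m' \<le> length (full_word n w)"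
    "point_marks z = {(m, t), (m', t)}"
proof -
  obtain m m' t where "z = ((m, m'), t)" by (metis surj_pair)
  with assms points that[of m m' t] show ?thesis
    by (auto simp: pair_space_def colour_pairs_def)
qed

lemma finite_marks: "finite (marks \<Sigma>)"
  unfolding marks_def using finite_points by (auto elim!: point_cases)

text \<open>The two marks of a point differ because \<open>m < m'\<close>, and marks of different
  points do not coincide by \<open>disjoint_marks\<close>.\<close>

lemma card_marks: "card (marks \<Sigma>) = 2 * card \<Sigma>"
proof -
  have "finite (point_marks z)" "card (point_marks z) = 2" if "z \<in> \<Sigma>" for z
    using that by (auto elim!: point_cases)
  then show ?thesis
    unfolding marks_def using finite_points disjoint
    by (subst card_UN_disjoint) (auto simp: disjoint_marks_def pairwise_def disjnt_def)
qed

text \<open>Two points sharing the mark \<open>x\<close> are equal by disjointness, so the definite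
  description in \<open>mark_mate\<close> denotes a unique mark.\<close>

lemma mark_mate_unique:
  assumes "z \<in> \<Sigma>" "point_marks z = {x, y}"
  shows "mark_mate \<Sigma> x = y"
  unfolding mark_mate_def
proof (rule the_equality)
  show "\<exists>z\<in>\<Sigma>. point_marks z = {x, y}" using assms by blast
  fix y' assume "\<exists>z\<in>\<Sigma>. point_marks z = {x, y'}"
  then obtain z' where z': "z' \<in> \<Sigma>" "point_marks z' = {x, y'}" by blast
  then have "\<not> disjnt (point_marks z) (point_marks z')"
    using assms by (auto simp: disjnt_def)
  then have "z' = z"
    using disjoint assms(1) z'(1) by (auto simp: disjoint_marks_def pairwise_def)
  then show "y' = y" using assms z' by (auto simp: doubleton_eq_iff)
qed

lemma mark_mate:
  assumes "x \<in> marks \<Sigma>"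
  shows "mark_mate \<Sigma> x \<in> marks \<Sigma>" "mark_mate \<Sigma> (mark_mate \<Sigma> x) = x" "mark_mate \<Sigma> x \<noteq> x"
proof -
  obtain z where z: "z \<in> \<Sigma>" "x \<in> point_marks z" using assms by (auto simp: marks_def)
  obtain y where y: "point_marks z = {x, y}" "x \<noteq> y"
  proof (rule point_cases[OF z(1)])
    fix m m' t assume "m < m'" "point_marks z = {(m, t), (m', t)}"
    then show thesis
      using z(2) that[of "(m, t)"] that[of "(m', t)"] by (auto simp: insert_commute)
  qed
  then have "mark_mate \<Sigma> x = y" "mark_mate \<Sigma> y = x"
    using mark_mate_unique[OF z(1), of x y] mark_mate_unique[OF z(1), of y x] by (simp_all add: insert_commute)
  then show "mark_mate \<Sigma> x \<in> marks \<Sigma>" "mark_mate \<Sigma> (mark_mate \<Sigma> x) = x" "mark_mate \<Sigma> x \<noteq> x"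
    using y z by (auto simp: marks_def)
qed

text \<open>On the labels, \<open>point_pairing\<close> is \<open>mark_mate\<close> conjugated by
  the bijection \<open>mark_label\<close>, which transports the properties of a fixed-point-free
  involution.\<close>

lemma point_pairing:
  assumes "p \<in> {1..2 * card \<Sigma>}"
  shows "point_pairing \<Sigma> p \<in> {1..2 * card \<Sigma>}" "point_pairing \<Sigma> (point_pairing \<Sigma> p) = p"
    "point_pairing \<Sigma> p \<noteq> p"
proof -
  have bij: "bij_betw (mark_label \<Sigma>) (marks \<Sigma>) {1..2 * card \<Sigma>}"
    using bij_betw_mark_label[OF finite_marks] by (simp add: card_marks)
  note inj = bij_betw_imp_inj_on[OF bij]
  obtain x where x: "x \<in> marks \<Sigma>" "p = mark_label \<Sigma> x"
    using assms bij_betw_imp_surj_on[OF bij] by blast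
  have label: "mark_label \<Sigma> y \<in> {1..2 * card \<Sigma>}" if "y \<in> marks \<Sigma>" for y
    using bij that by (auto simp: bij_betw_def)
  have pairing: "point_pairing \<Sigma> (mark_label \<Sigma> y) = mark_label \<Sigma> (mark_mate \<Sigma> y)"
    if "y \<in> marks \<Sigma>" for y
    using label[OF that] that by (simp add: point_pairing_def the_inv_into_f_f[OF inj])
  show "point_pairing \<Sigma> p \<in> {1..2 * card \<Sigma>}" "point_pairing \<Sigma> (point_pairing \<Sigma> p) = p"
    "point_pairing \<Sigma> p \<noteq> p"
    using x mark_mate[OF x(1)] label inj_onD[OF inj] by (metis pairing)+
qed

text \<open>The positions belonging to the \<open>i\<close>-th word form the block
  \<open>boundary_labels\<close> taken with word lengths in place of \<open>K\<close>. The facts on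
  blocks of labels therefore also split the marks among the words.\<close>

lemma sum_mark_count: "(\<Sum>i\<in>{1..n}. mark_count w \<Sigma> i) = 2 * card \<Sigma>"
proof -
  let ?len = "\<lambda>i. length (w i)"
  define A where "A i = {x \<in> marks \<Sigma>. fst x \<in> boundary_labels ?len i}" for i
  have count: "mark_count w \<Sigma> i = card (A i)" for i
    unfolding mark_count_def A_def boundary_labels_def label_offset_def
    by (rule arg_cong[of _ _ card]) auto
  have total: "length (full_word n w) = (\<Sum>i\<in>{1..n}. ?len i)"
    by (induction n) (simp_all add: full_word_def)
  have "fst x \<in> all_labels n ?len" if "x \<in> marks \<Sigma>" for x
    using that total by (auto simp: all_labels_eq marks_def elim!: point_cases)
  then have "marks \<Sigma> = (\<Union>i\<in>{1..n}. A i)"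
    unfolding A_def all_labels_def by blast
  moreover have "A i \<inter> A j = {}" if "i \<in> {1..n}" "j \<in> {1..n}" "i \<noteq> j" for i j
    using that boundary_labels_unique[of _ ?len i j] by (auto simp: A_def)
  ultimately show ?thesis
    using card_UN_disjoint[of "{1..n}" A] finite_marks
    by (simp add: count A_def flip: card_marks)
qed

end

text \<open>From here on, the gluing results hold for the pairing induced by
  \<open>\<Sigma>\<close>, with \<open>k\<close> equal to \<open>card \<Sigma>\<close>.\<close>

sublocale point_configuration \<subseteq> edge_pairing n "mark_count w \<Sigma>" "point_pairing \<Sigma>" "card \<Sigma>"
  using sum_mark_count point_pairing by unfold_locales

theorem lemma4p18:
  fixes M :: "'a measure"
    and J :: "'j set" and X :: "'j \<Rightarrow> complex^'N^'N" and B :: "'j \<Rightarrow> 'a \<Rightarrow> real"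
    and W :: "'a \<Rightarrow> complex^'N^'N"
    and V :: "complex set" and E :: "'e set" and \<gamma> :: "'e \<Rightarrow> real \<Rightarrow> complex" and v :: complex
    and L :: nat and F :: "nat \<Rightarrow> complex set" and l :: "nat \<Rightarrow> 'e walk"
    and \<phi> :: "nat \<Rightarrow> real \<Rightarrow> complex"
    and n :: nat and \<Gamma> :: "nat \<Rightarrow> 'e walk" and w :: "nat \<Rightarrow> lasso_word"
    and \<Sigma> :: "pair_point set"
  assumes "prob_space M"
    and "u_brownian_at_one M J X B W"
    and "plane_graph V E \<gamma>" and "v \<in> V"
    and "lasso_basis V E \<gamma> v L F l"
    and "\<And>k. k \<in> {1..L} \<Longrightarrow> parametrizes_region (\<phi> k) (F k)"
    and "\<And>i. i \<in> {1..n} \<Longrightarrow> is_walk E \<gamma> v (\<Gamma> i) v"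
    and "\<And>i. i \<in> {1..n} \<Longrightarrow> lasso_representation L l (\<Gamma> i) (w i)"
    and "finite \<Sigma>" and "\<Sigma> \<subseteq> pair_space n w" and "disjoint_marks \<Sigma>"
  shows "(\<Sum>a\<in>cyclic_indices n (mark_count w \<Sigma>).
            wick_product M (card \<Sigma>) (point_pairing \<Sigma>)
              (entry_sequence n (mark_count w \<Sigma>) W a))
         = (-1) ^ card \<Sigma> *
           of_nat CARD('N) powi
             (- int n + total_euler_char n (mark_count w \<Sigma>) (point_pairing \<Sigma>))"
proof -
  interpret point_configuration n w \<Sigma>
    using assms(9-11) by unfold_locales
  show ?thesis
    using assms(1,2) by (rule sum_wick_product)
qed

end
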